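(* Let $\alpha>0$ and let $n\in\{0,1,2,\dots\}$ be fixed. Then the function $a_n=a_n(s)$ satisfies, for $s>0$, $$a_n''=\frac{(a_n')^2}{a_n}-\frac{a_n'}{s}+(2n+1+\alpha)\frac{a_n^2}{s^2}+\frac{a_n^3}{s^2}+\frac{\alpha}{s}-\frac{1}{a_n},$$ with the initial conditions $$a_n(0)=0,\qquad a_n'(0)=\frac1\alpha .$$ Moreover, if $a_n(s)=:-q(s)$, then $q$ solves the equation $P_{III'}(-4(2n+1+\alpha),-4\alpha,4,-4)$.
   Context: Fix $\alpha>0$. For $s\ge 0$ let $w(x,s)=x^{\alpha}e^{-x-s/x}$ on $(0,\infty)$ (so $w(x,0)=x^\alpha e^{-x}$). Let $P_n(x)=P_n(x,s)$, $n\ge0$, be the monic polynomials of degree $n$ with $\int_0^\infty P_jP_k\,w(x,s)\,dx=h_j(s)\delta_{jk}$. Define $$a_n(s):=\frac{s}{h_n(s)}\int_0^\infty\frac{P_n(y,s)^2}{y}\,w(y,s)\,dy .$$ Primes denote $d/ds$; the derivative at $s=0$ is the one-sided (right) derivative. $P_{III'}(A,B,C,D)$ (Okamoto's convention) denotes the equation $$q''=\frac{(q')^2}{q}-\frac{q'}{s}+\frac{q^2}{4s^2}(A+Cq)+\frac{B}{4s}+\frac{D}{4q}.$$ *)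

theory Defs
  imports "HOL-Analysis.Analysis" "HOL-Computational_Algebra.Polynomial"
begin

definition weight :: "real \<Rightarrow> real \<Rightarrow> real \<Rightarrow> real" where
  "weight \<alpha> s x = x powr \<alpha> * exp (- x - s / x)"

text \<open>
  All integrands below are integrable when \<^term>\<open>\<alpha> > 0\<close> and \<^term>\<open>s \<ge> 0\<close>, so the convention
  that non-integrable functions have Bochner integral 0 never comes into play.
\<close>

definition monic_orthogonal ::
    "real \<Rightarrow> real \<Rightarrow> (nat \<Rightarrow> real poly) \<Rightarrow> (nat \<Rightarrow> real) \<Rightarrow> bool" where
  "monic_orthogonal \<alpha> s P h \<longleftrightarrow>
     (\<forall>n. degree (P n) = n \<and> lead_coeff (P n) = 1) \<and>
     (\<forall>j k. (LBINT x:{0<..}. poly (P j) x * poly (P k) x * weight \<alpha> s x)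
              = (if j = k then h j else 0))"

definition aux_a ::
    "real \<Rightarrow> (nat \<Rightarrow> real \<Rightarrow> real poly) \<Rightarrow> (nat \<Rightarrow> real \<Rightarrow> real) \<Rightarrow> nat \<Rightarrow> real \<Rightarrow> real" where
  "aux_a \<alpha> P h n s =
     s / h n s * (LBINT y:{0<..}. (poly (P n s) y)\<^sup>2 / y * weight \<alpha> s y)"

text \<open>
  A solution on \<open>(0, \<infinity>)\<close> of \<open>y'' = F s y y'\<close>, where \<open>F\<close> may have a pole at \<open>y = 0\<close>:
  since division by zero and the derivative of a non-differentiable function are total in HOL,
  nonvanishing and twofold differentiability have to be required explicitly.
\<close>

definition solves_ode2_on_pos ::
    "(real \<Rightarrow> real \<Rightarrow> real \<Rightarrow> real) \<Rightarrow> (real \<Rightarrow> real) \<Rightarrow> bool" where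
  "solves_ode2_on_pos F y \<longleftrightarrow>
     (\<forall>s>0. y s \<noteq> 0 \<and> y differentiable (at s) \<and> deriv y differentiable (at s) \<and>
            deriv (deriv y) s = F s (y s) (deriv y s))"

definition PIII' :: "real \<Rightarrow> real \<Rightarrow> real \<Rightarrow> real \<Rightarrow> (real \<Rightarrow> real) \<Rightarrow> bool" where
  "PIII' A B C D = solves_ode2_on_pos
     (\<lambda>s q q'. q'\<^sup>2 / q - q' / s + q\<^sup>2 / (4 * s\<^sup>2) * (A + C * q) + B / (4 * s) + D / (4 * q))"

end

theory Submission
  imports Defs "HOL-Real_Asymp.Real_Asymp"
begin

text \<open>
  Write \<open>E p\<close> and \<open>F p\<close> for the integrals of \<open>p w\<close> and \<open>p w / x\<close>, and put
  \<open>b\<^sub>n = s F(P\<^sub>n P\<^sub>n\<^sub>-\<^sub>1) / h\<^sub>n\<^sub>-\<^sub>1\<close>. Let \<open>\<alpha>\<^sub>n\<close> and \<open>\<beta>\<^sub>n\<close> be the coefficients of the three-term recurrence and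
  \<open>p\<^sub>n\<close> the subleading coefficient of \<open>P\<^sub>n\<close>. From \<open>F(x p) = E p\<close>, integration by parts against
  \<open>x w\<close> and the three-term recurrence one obtains, for fixed \<open>s\<close>, the compatibility relations
  \<open>\<alpha>\<^sub>n = 2n + 1 + \<alpha> + a\<^sub>n\<close>, \<open>b\<^sub>n\<^sub>+\<^sub>1 + b\<^sub>n = s - \<alpha>\<^sub>n a\<^sub>n\<close>, \<open>\<beta>\<^sub>n = b\<^sub>n - p\<^sub>n\<close>,
  \<open>b\<^sub>n\<^sup>2 - s b\<^sub>n = \<beta>\<^sub>n a\<^sub>n a\<^sub>n\<^sub>-\<^sub>1\<close> and \<open>\<beta>\<^sub>n (a\<^sub>n + a\<^sub>n\<^sub>-\<^sub>1) = n s - (2n + \<alpha>) b\<^sub>n\<close>. Differentiating the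
  orthogonality relations in \<open>s\<close> gives \<open>s h\<^sub>n' = - a\<^sub>n h\<^sub>n\<close> and \<open>s p\<^sub>n' = b\<^sub>n\<close>. Together these form a closed
  first-order system for \<open>(a\<^sub>n, b\<^sub>n)\<close>, and eliminating \<open>b\<^sub>n\<close> yields the Painleve equation.
  The slope at \<open>0\<close> is the limit of \<open>a\<^sub>n(s) / s\<close>, found by integrating \<open>(P\<^sub>n\<^sup>2 w)'\<close> at \<open>s = 0\<close>.
\<close>

subsection \<open>Moments of the weight\<close>

lemma weight_nonneg: "weight c s x \<ge> 0"
  by (simp add: weight_def)

lemma weight_add1: "x > 0 \<Longrightarrow> weight (c + 1) s x = x * weight c s x"
  by (simp add: weight_def powr_add)

lemma weight_diff1: "x > 0 \<Longrightarrow> weight (c - 1) s x = weight c s x / x"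
  by (simp add: weight_def powr_diff)

lemma measurable_weight [measurable]: "weight c s \<in> borel_measurable borel"
  unfolding weight_def by measurable

lemma integrable_weight_zero:
  assumes "c > -1" shows "set_integrable lborel {0<..} (weight c 0)"
proof -
  have "set_integrable lebesgue {0<..} (\<lambda>t. complex_of_real t powr (complex_of_real (c + 1) - 1) / of_real (exp t))"
    using absolutely_integrable_Gamma_integral'[of "complex_of_real (c+1)"] assms by simp
  then have "set_integrable lebesgue {0<..} (\<lambda>t. norm (complex_of_real t powr (complex_of_real (c + 1) - 1) / of_real (exp t)))"
    by (rule set_integrable_norm)
  also have "?this \<longleftrightarrow> set_integrable lebesgue {0<..} (weight c 0)"
    by (intro set_integrable_cong) (auto simp: weight_def norm_divide norm_powr_real_powr exp_minus field_simps)
  finally show ?thesis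
    unfolding set_integrable_def by (subst (asm) integrable_completion) auto
qed

lemma integrable_weight_bound:
  assumes "C \<ge> 0" "d > -1" and "\<And>x. x > 0 \<Longrightarrow> weight c s x \<le> C * weight d 0 x"
  shows "set_integrable lborel {0<..} (weight c s)"
proof (rule set_integrable_bound)
  show "set_integrable lborel {0<..} (\<lambda>x. C * weight d 0 x)"
    using assms(2) by (intro set_integrable_mult_right integrable_weight_zero) auto
  show "set_borel_measurable lborel {0<..} (weight c s)"
    unfolding set_borel_measurable_def by measurable
  show "AE x in lborel. x \<in> {0<..} \<longrightarrow> norm (weight c s x) \<le> norm (C * weight d 0 x)"
    using assms by (intro AE_I2) (auto simp: weight_nonneg abs_mult)
qed

lemma weight_le_zero: "s \<ge> 0 \<Longrightarrow> x > 0 \<Longrightarrow> weight c s x \<le> weight c 0 x"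
  by (simp add: weight_def)

lemma integrable_weight:
  assumes "c > -1" "s \<ge> 0" shows "set_integrable lborel {0<..} (weight c s)"
  by (rule integrable_weight_bound[of 1 c]) (use assms weight_le_zero in auto)

text \<open>The factor \<open>exp (- s / x)\<close> is at most \<open>x / s\<close>, which gains one
  power of \<open>x\<close> at the origin. For \<open>s > 0\<close> this admits
  \<open>weight (c - 1) s\<close> with \<open>c > -1\<close> and \<open>weight (c - 2) s\<close>
  with \<open>c > 0\<close>.\<close>

lemma integrable_weight_pos:
  assumes "c > -2" "s > 0" shows "set_integrable lborel {0<..} (weight c s)"
proof (rule integrable_weight_bound[of "1/s" "c+1"])
  fix x :: real assume x: "x > 0"
  have "s / x \<le> exp (s / x)"
    using exp_ge_add_one_self[of "s/x"] by linarith
  then have "exp (-(s / x)) \<le> x / s"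
    using x assms by (simp add: exp_minus field_simps)
  then have "x powr c * exp (-x) * exp (-(s / x)) \<le> x powr c * exp (-x) * (x / s)"
    by (intro mult_left_mono) auto
  moreover have "weight c s x = x powr c * exp (-x) * exp (-(s / x))"
    by (simp add: weight_def mult.assoc flip: exp_add)
  ultimately show "weight c s x \<le> 1 / s * weight (c + 1) 0 x"
    using x by (simp add: weight_def powr_add mult_ac)
qed (use assms in auto)

text \<open>At \<open>s = 0\<close> and \<open>c > -1\<close> this is the Gamma function at
  \<open>c + 1\<close>; for \<open>s > 0\<close> it is \<open>2 * s powr ((c + 1) / 2)\<close> times
  the modified Bessel function K of order \<open>c + 1\<close> at \<open>2 * sqrt s\<close>.\<close>

definition mom :: "real \<Rightarrow> real \<Rightarrow> real" where
  "mom c s = (LBINT x:{0<..}. weight c s x)"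

lemma DERIV_weight:
  assumes "x > 0"
  shows "(weight (c + 1) s has_real_derivative
    (c + 1) * weight c s x - weight (c + 1) s x + s * weight (c - 1) s x) (at x)"
proof -
  let ?E = "exp (- x - s / x)"
  have "((\<lambda>x. x powr (c + 1) * exp (- x - s / x)) has_real_derivative
    (c + 1) * x powr (c + 1 - 1) * ?E + ?E * (- 1 + s / x\<^sup>2) * x powr (c + 1)) (at x)"
    using assms by (auto intro!: derivative_eq_intros simp: power2_eq_square)
  moreover have *: "x powr (c + 1) * s / x\<^sup>2 = s * x powr (c - 1)"
    using assms by (simp add: powr_add powr_diff power2_eq_square)
  have "(c + 1) * x powr (c + 1 - 1) * ?E + ?E * (- 1 + s / x\<^sup>2) * x powr (c + 1)
    = (c + 1) * (x powr c * ?E) - x powr (c + 1) * ?E + x powr (c + 1) * s / x\<^sup>2 * ?E"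
    by (simp add: algebra_simps)
  then have "(c + 1) * x powr (c + 1 - 1) * ?E + ?E * (- 1 + s / x\<^sup>2) * x powr (c + 1)
    = (c + 1) * weight c s x - weight (c + 1) s x + s * weight (c - 1) s x"
    unfolding weight_def * by (simp only: mult.assoc)
  ultimately show ?thesis unfolding weight_def by (simp only:)
qed

text \<open>Integrate the derivative of \<open>weight (c + 1) s\<close> over the half-line; as
  \<open>c + 1 > 0\<close>, both boundary terms vanish.\<close>

lemma mom_recurrence:
  assumes c: "c > -1" and s: "s \<ge> 0"
  shows "(c + 1) * mom c s - mom (c + 1) s + s * mom (c - 1) s = 0"
proof -
  let ?f = "\<lambda>x. (c + 1) * weight c s x - weight (c + 1) s x + s * weight (c - 1) s x"
  have i1: "set_integrable lborel {0<..} (weight c s)" "set_integrable lborel {0<..} (weight (c+1) s)"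
    using c s by (auto intro: integrable_weight)
  \<comment> \<open>At \<open>s = 0\<close> the function \<open>weight (c - 1) 0\<close> may fail to
    be integrable; the factor \<open>s\<close> then removes it.\<close>
  have i2: "set_integrable lborel {0<..} (\<lambda>x. s * weight (c - 1) s x)"
  proof (cases "s = 0")
    case False
    then show ?thesis using c s by (intro set_integrable_mult_right integrable_weight_pos) auto
  qed (simp add: set_integrable_def)
  note i = i1 i2
  have i3: "set_integrable lborel {0<..} ?f"
    by (intro set_integral_add set_integral_diff set_integrable_mult_right i)
  have zero: "((weight (c + 1) s) \<longlongrightarrow> 0) (at_right 0)"
  proof (rule tendsto_sandwich[of "\<lambda>_. 0" _ _ "\<lambda>x. x powr (c + 1)"])
    show "((\<lambda>x. x powr (c + 1)) \<longlongrightarrow> 0) (at_right 0)" using c by real_asymp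
    show "\<forall>\<^sub>F x in at_right 0. weight (c + 1) s x \<le> x powr (c + 1)"
      using eventually_at_right_less[of 0]
    proof eventually_elim
      case (elim x)
      then have "s / x \<ge> 0" using s by simp
      then have "exp (-x - s / x) \<le> 1" using elim unfolding exp_le_one_iff by linarith
      then show ?case unfolding weight_def by (simp add: mult_left_le)
    qed
  qed (auto simp: weight_nonneg)
  have infty: "((weight (c + 1) s) \<longlongrightarrow> 0) at_top"
  proof (rule tendsto_sandwich[of "\<lambda>_. 0" _ _ "weight (c + 1) 0"])
    show "((weight (c + 1) 0) \<longlongrightarrow> 0) at_top" unfolding weight_def using c by real_asymp
    show "\<forall>\<^sub>F x in at_top. weight (c + 1) s x \<le> weight (c + 1) 0 x"
      using eventually_gt_at_top[of 0] by eventually_elim (use s in \<open>auto intro: weight_le_zero\<close>)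
  qed (auto simp: weight_nonneg)
  have e: "einterval 0 \<infinity> = {0<..}" by (auto simp: einterval_def)
  have "(LBINT x=0..\<infinity>. ?f x) = 0 - 0"
  proof (rule interval_integral_FTC_integrable)
    show "((weight (c + 1) s \<circ> real_of_ereal) \<longlongrightarrow> 0) (at_right 0)"
      using zero by (simp add: ereal_tendsto_simps zero_ereal_def)
    show "((weight (c + 1) s \<circ> real_of_ereal) \<longlongrightarrow> 0) (at_left \<infinity>)"
      using infty by (simp add: ereal_tendsto_simps)
    show "set_integrable lborel (einterval 0 \<infinity>) ?f" using i3 e by simp
    show "isCont ?f x" if "0 < ereal x" for x
      using that unfolding weight_def by (auto intro!: continuous_intros)
    show "(weight (c + 1) s has_vector_derivative ?f x) (at x)" if "0 < ereal x" for x
      using that DERIV_weight[of x c s] by (simp add: has_real_derivative_iff_has_vector_derivative)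
  qed auto
  then have "(LBINT x:{0<..}. ?f x) = 0"
    by (simp add: interval_lebesgue_integral_def e)
  moreover have "(LBINT x:{0<..}. ?f x) = (c + 1) * mom c s - mom (c + 1) s + s * mom (c - 1) s"
    using i by (simp add: mom_def set_integral_add set_integral_diff)
  ultimately show ?thesis by simp
qed

text \<open>Since \<open>c\<close> may be negative, a bound linear in \<open>s\<close> could require
  the divergent integral of \<open>weight (c - 1) 0\<close>. The Hoelder bound
  \<open>1 - exp (- u) \<le> u powr t\<close> at \<open>u = s / x\<close> costs only the power
  \<open>t\<close>.\<close>

lemma mom_continuous_zero:
  assumes "c > -1"
  shows "continuous (at 0 within {0..}) (mom c)"
proof -
  \<comment> \<open>The cap \<open>1\<close> serves the Hoelder bound for \<open>u \<le> 1\<close>;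
    half the distance from \<open>c\<close> to \<open>-1\<close> keeps
    \<open>weight (c - t) 0\<close> integrable.\<close>
  define t where "t = min 1 ((c + 1) / 2)"
  have t: "t > 0" "t \<le> 1" "c - t > -1" using assms by (auto simp: t_def min_def field_simps)
  have ex: "1 - exp (-u) \<le> u powr t" if "u \<ge> 0" for u :: real
  proof (cases "u \<le> 1")
    case True
    have "1 - exp (-u) \<le> u" using exp_ge_add_one_self[of "-u"] by linarith
    also have "u \<le> u powr t" using powr_mono'[of t 1 u] True that t by simp
    finally show ?thesis .
  next
    case False
    then have "1 \<le> u powr t" using t by (intro ge_one_powr_ge_zero) auto
    then show ?thesis by (smt (verit) exp_ge_zero)
  qed
  have bound: "\<bar>mom c s - mom c 0\<bar> \<le> s powr t * mom (c - t) 0" if s: "s \<ge> 0" for s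
  proof -
    have i: "set_integrable lborel {0<..} (weight c s)" "set_integrable lborel {0<..} (weight c 0)"
       "set_integrable lborel {0<..} (weight (c - t) 0)"
      using assms s t by (auto intro: integrable_weight)
    have 1: "mom c s \<le> mom c 0" unfolding mom_def
      using i weight_le_zero[OF s] by (intro set_integral_mono) auto
    have "mom c 0 - mom c s = (LBINT x:{0<..}. weight c 0 x - weight c s x)"
      using i by (simp add: mom_def set_integral_diff)
    also have "\<dots> \<le> (LBINT x:{0<..}. s powr t * weight (c - t) 0 x)"
    proof (intro set_integral_mono set_integral_diff set_integrable_mult_right i)
      fix x :: real assume "x \<in> {0<..}"
      then have x: "x > 0" by simp
      have "weight c 0 x - weight c s x = x powr c * exp (-x) * (1 - exp (-(s / x)))"
        by (simp add: weight_def exp_diff exp_minus field_simps)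
      also have "\<dots> \<le> x powr c * exp (-x) * (s / x) powr t"
        using x s by (intro mult_left_mono ex) auto
      also have "\<dots> = s powr t * weight (c - t) 0 x"
        using x s by (simp add: weight_def powr_diff powr_divide)
      finally show "weight c 0 x - weight c s x \<le> s powr t * weight (c - t) 0 x" .
    qed
    finally show ?thesis using 1 by (simp add: mom_def)
  qed
  have "((\<lambda>s. mom c s - mom c 0) \<longlongrightarrow> 0) (at 0 within {0..})"
  proof (rule Lim_null_comparison)
    show "\<forall>\<^sub>F s in at 0 within {0..}. norm (mom c s - mom c 0) \<le> s powr t * mom (c - t) 0"
      using bound by (auto simp: eventually_at_filter intro: always_eventually)
    have "((\<lambda>s. s powr t) \<longlongrightarrow> 0) (at_right 0)" using t by real_asymp
    then have "((\<lambda>s. s powr t) \<longlongrightarrow> 0) (at 0 within {0..})"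
      by (simp add: at_within_Ici_at_right)
    from tendsto_mult_left_zero[OF this] show "((\<lambda>s. s powr t * mom (c - t) 0) \<longlongrightarrow> 0) (at 0 within {0..})" .
  qed
  then show ?thesis by (simp add: continuous_within LIM_zero_iff)
qed

text \<open>Multiplying \<open>1 + t \<le> exp t\<close> by \<open>exp (- t)\<close> bounds the
  Taylor remainder by \<open>t * (1 - exp (- t))\<close>; inequalities of the same kind bound the
  second factor for either sign of \<open>t\<close>.\<close>

lemma exp_minus_quadratic_bound: "\<bar>exp (- t) - 1 + t\<bar> \<le> t\<^sup>2 * exp \<bar>t\<bar>" for t :: real
proof -
  have 0: "exp (- t) - 1 + t \<ge> 0" using exp_ge_add_one_self[of "-t"] by linarith
  have "exp (-t) * (1 + t) \<le> exp (-t) * exp t" by (intro mult_left_mono) auto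
  then have a: "exp (-t) + t * exp (-t) \<le> 1" by (simp add: exp_minus field_simps)
  then have 1: "exp (- t) - 1 + t \<le> t * (1 - exp (-t))" by (simp add: algebra_simps)
  also have "\<dots> \<le> t\<^sup>2 * exp \<bar>t\<bar>"
  proof (cases "t \<ge> 0")
    case True
    then have "1 - exp (-t) \<le> t * 1" using exp_ge_add_one_self[of "-t"] by linarith
    also have "t * 1 \<le> t * exp \<bar>t\<bar>" using True by (intro mult_left_mono) auto
    finally show ?thesis using True by (simp add: power2_eq_square mult.assoc mult_left_mono)
  next
    case False
    then have "exp (-t) - 1 \<le> (-t) * exp (-t)" using a by simp
    then have "(-t) * (exp (-t) - 1) \<le> (-t) * ((-t) * exp (-t))" using False by (intro mult_left_mono) auto
    then show ?thesis using False by (simp add: power2_eq_square algebra_simps)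
  qed
  finally show ?thesis using 0 by simp
qed

text \<open>Half of \<open>s / x\<close> absorbs the growth of \<open>exp \<bar>d / x\<bar>\<close>,
  so the majorant \<open>weight (c - 2) (s / 2)\<close> does not depend on \<open>d\<close>.\<close>

lemma weight_quadratic_bound:
  assumes x: "x > 0" and d: "\<bar>d\<bar> \<le> s / 2"
  shows "\<bar>weight c (s + d) x - weight c s x + d * weight (c - 1) s x\<bar>
    \<le> d\<^sup>2 * weight (c - 2) (s / 2) x"
proof -
  let ?t = "d / x"
  have "weight c (s + d) x - weight c s x + d * weight (c - 1) s x
    = weight c s x * (exp (- ?t) - 1 + ?t)"
  proof -
    have "exp (- x - (s + d) / x) = exp (- x - s / x) * exp (- ?t)"
      by (simp add: exp_add[symmetric] add_divide_distrib)
    then have "weight c (s + d) x = weight c s x * exp (- ?t)" by (simp add: weight_def)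
    with x show ?thesis by (simp add: weight_diff1 algebra_simps)
  qed
  then have "\<bar>weight c (s + d) x - weight c s x + d * weight (c - 1) s x\<bar>
    = weight c s x * \<bar>exp (- ?t) - 1 + ?t\<bar>"
    by (simp add: abs_mult weight_nonneg)
  also have "\<dots> \<le> weight c s x * (?t\<^sup>2 * exp \<bar>?t\<bar>)"
    by (intro mult_left_mono exp_minus_quadratic_bound weight_nonneg)
  also have "\<dots> = ?t\<^sup>2 * x powr c * exp (- x - s / x + \<bar>?t\<bar>)"
    by (simp add: weight_def exp_add)
  also have "\<dots> \<le> ?t\<^sup>2 * x powr c * exp (- x - s / 2 / x)"
  proof -
    have "\<bar>?t\<bar> \<le> s / 2 / x" using divide_right_mono[OF d, of x] x by (simp add: abs_divide)
    moreover have "s / x = s / 2 / x + s / 2 / x" by simp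
    ultimately have "- x - s / x + \<bar>?t\<bar> \<le> - x - s / 2 / x" by linarith
    then show ?thesis by (intro mult_left_mono) auto
  qed
  also have "\<dots> = d\<^sup>2 * weight (c - 2) (s / 2) x"
    using x by (simp add: weight_def powr_diff power_divide)
  finally show ?thesis .
qed

text \<open>Differentiation under the integral: the pointwise remainder, integrated, makes the error
  of the difference quotient O(d).\<close>

lemma mom_has_derivative:
  assumes c: "c > 0" and s: "s > 0"
  shows "(mom c has_real_derivative - mom (c - 1) s) (at s)"
proof -
  have bound: "\<bar>mom c (s + d) - mom c s + d * mom (c - 1) s\<bar> \<le> d\<^sup>2 * mom (c - 2) (s / 2)"
    if d: "\<bar>d\<bar> \<le> s / 2" for d
  proof -
    have i: "set_integrable lborel {0<..} (weight c (s + d))" "set_integrable lborel {0<..} (weight c s)"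
      "set_integrable lborel {0<..} (weight (c - 1) s)" "set_integrable lborel {0<..} (weight (c - 2) (s / 2))"
      using c s d by (auto intro: integrable_weight integrable_weight_pos)
    let ?f = "\<lambda>x. weight c (s + d) x - weight c s x + d * weight (c - 1) s x"
    have j: "set_integrable lborel {0<..} ?f"
      by (intro set_integral_add set_integral_diff set_integrable_mult_right i)
    have "mom c (s + d) - mom c s + d * mom (c - 1) s = (LBINT x:{0<..}. ?f x)"
      using i by (simp add: mom_def set_integral_add set_integral_diff)
    then have "\<bar>mom c (s + d) - mom c s + d * mom (c - 1) s\<bar> = \<bar>LBINT x:{0<..}. ?f x\<bar>" by simp
    also have "\<dots> \<le> (LBINT x:{0<..}. \<bar>?f x\<bar>)"
      using set_integral_norm_bound[OF j] by simp
    also have "\<dots> \<le> (LBINT x:{0<..}. d\<^sup>2 * weight (c - 2) (s / 2) x)"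
      using d by (intro set_integral_mono set_integrable_mult_right set_integrable_abs j i
        weight_quadratic_bound) auto
    finally show ?thesis by (simp add: mom_def)
  qed
  have "((\<lambda>d. (mom c (s + d) - mom c s) / d - (- mom (c - 1) s)) \<longlongrightarrow> 0) (at 0)"
  proof (rule Lim_null_comparison)
    have "\<forall>\<^sub>F d in at 0. \<bar>d\<bar> < s / 2 \<and> d \<noteq> (0::real)"
      using s by (auto simp: eventually_at dist_real_def intro!: exI[of _ "s/2"])
    then show "\<forall>\<^sub>F d in at 0. norm ((mom c (s + d) - mom c s) / d - (- mom (c - 1) s))
        \<le> \<bar>d\<bar> * mom (c - 2) (s / 2)"
    proof eventually_elim
      case (elim d)
      have "(mom c (s + d) - mom c s) / d - (- mom (c - 1) s)
        = (mom c (s + d) - mom c s + d * mom (c - 1) s) / d"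
        using elim by (simp add: field_simps)
      then have "norm ((mom c (s + d) - mom c s) / d - (- mom (c - 1) s))
        = \<bar>mom c (s + d) - mom c s + d * mom (c - 1) s\<bar> / \<bar>d\<bar>" by simp
      also have "\<dots> \<le> d\<^sup>2 * mom (c - 2) (s / 2) / \<bar>d\<bar>"
        using bound[of d] elim by (intro divide_right_mono) auto
      also have "\<dots> = \<bar>d\<bar> * mom (c - 2) (s / 2)"
        using elim by (simp add: power2_eq_square field_simps abs_if)
      finally show ?case .
    qed
    show "((\<lambda>d. \<bar>d\<bar> * mom (c - 2) (s / 2)) \<longlongrightarrow> 0) (at 0)"
      by (auto intro!: tendsto_eq_intros)
  qed
  then show ?thesis unfolding DERIV_def by (rule LIM_zero_cancel)
qed

subsection \<open>The moment functional\<close>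

text \<open>The functionals \<open>E\<close> and \<open>F\<close> are the cases
  \<open>c = \<alpha>\<close> and \<open>c = \<alpha> - 1\<close>. With \<open>c\<close> as a
  parameter, multiplying by \<open>x\<close> is a shift of \<open>c\<close> by one.\<close>

definition lin :: "real \<Rightarrow> real \<Rightarrow> real poly \<Rightarrow> real" where
  "lin c s p = (LBINT x:{0<..}. poly p x * weight c s x)"

lemma weight_add_nat: "x > 0 \<Longrightarrow> weight (c + real i) s x = x ^ i * weight c s x"
  by (simp add: weight_def powr_add powr_realpow)

lemma poly_weight_eq_sum:
  assumes "degree p \<le> N" "x > 0"
  shows "poly p x * weight c s x = (\<Sum>i\<le>N. coeff p i * weight (c + real i) s x)"
proof -
  have "poly p x = (\<Sum>i\<le>N. coeff p i * x ^ i)"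
    unfolding poly_altdef using assms
    by (intro sum.mono_neutral_left) (auto simp: coeff_eq_0)
  then show ?thesis
    using assms by (simp add: sum_distrib_right weight_add_nat mult.assoc)
qed

lemma integrable_poly_weight:
  assumes "c > -1" "s \<ge> 0"
  shows "set_integrable lborel {0<..} (\<lambda>x. poly p x * weight c s x)"
proof -
  have "set_integrable lborel {0<..} (\<lambda>x. \<Sum>i\<le>degree p. coeff p i * weight (c + real i) s x)"
    unfolding set_integrable_def scaleR_sum_right using assms
    by (intro Bochner_Integration.integrable_sum)
       (rule set_integrable_mult_right[OF integrable_weight, unfolded set_integrable_def], auto)
  also have "?this \<longleftrightarrow> ?thesis"
    by (intro set_integrable_cong) (auto simp: poly_weight_eq_sum[OF order_refl])
  finally show ?thesis .
qed

text \<open>A bound \<open>N\<close> instead of the degree keeps the range of summation fixed when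
  \<open>p\<close> varies with \<open>s\<close>.\<close>

lemma lin_eq_sum:
  assumes "c > -1" "s \<ge> 0" "degree p \<le> N"
  shows "lin c s p = (\<Sum>i\<le>N. coeff p i * mom (c + real i) s)"
proof -
  have "lin c s p = (LBINT x:{0<..}. \<Sum>i\<le>N. coeff p i * weight (c + real i) s x)"
    unfolding lin_def using assms by (intro set_lebesgue_integral_cong) (auto simp: poly_weight_eq_sum)
  also have "\<dots> = (\<Sum>i\<le>N. LBINT x:{0<..}. coeff p i * weight (c + real i) s x)"
    unfolding set_lebesgue_integral_def scaleR_sum_right using assms
    by (intro Bochner_Integration.integral_sum)
       (rule set_integrable_mult_right[OF integrable_weight, unfolded set_integrable_def], auto)
  finally show ?thesis by (simp add: mom_def)
qed

lemma lin_add: "c > -1 \<Longrightarrow> s \<ge> 0 \<Longrightarrow> lin c s (p + q) = lin c s p + lin c s q"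
  unfolding lin_def by (simp add: distrib_right set_integral_add integrable_poly_weight)

lemma lin_smult: "lin c s (smult a p) = a * lin c s p"
  unfolding lin_def by (simp add: mult.assoc)

lemma lin_uminus: "lin c s (- p) = - lin c s p"
  using lin_smult[of c s "-1" p] by simp

lemma lin_diff: "c > -1 \<Longrightarrow> s \<ge> 0 \<Longrightarrow> lin c s (p - q) = lin c s p - lin c s q"
  using lin_add[of c s p "-q"] by (simp add: lin_uminus)

lemma lin_0 [simp]: "lin c s 0 = 0"
  by (simp add: lin_def)

lemma lin_const: "lin c s [:a:] = a * mom c s"
  by (simp add: lin_def mom_def)

lemma lin_X: "lin c s (pCons 0 p) = lin (c + 1) s p"
  unfolding lin_def by (intro set_lebesgue_integral_cong) (auto simp: weight_add1)

lemma lin_pCons: "c > -1 \<Longrightarrow> s \<ge> 0 \<Longrightarrow> lin c s (pCons a p) = a * mom c s + lin (c + 1) s p"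
  using lin_add[of c s "[:a:]" "pCons 0 p"] by (simp add: lin_const lin_X)

lemmas lin_simps = lin_add lin_diff lin_smult lin_uminus lin_const lin_pCons

text \<open>A vanishing integral would force the nonnegative integrand to vanish almost everywhere,
  so \<open>(0, \<infinity>)\<close> minus the finitely many roots of \<open>p\<close> would be a
  null set.\<close>

lemma lin_square_pos:
  assumes "c > -1" "s \<ge> 0" "p \<noteq> 0"
  shows "lin c s (p * p) > 0"
proof (rule ccontr)
  have nn: "lin c s (p * p) \<ge> 0" unfolding lin_def set_lebesgue_integral_def
    by (intro integral_nonneg_AE) (auto simp: weight_nonneg)
  assume "\<not> ?thesis"
  with nn have z: "lin c s (p * p) = 0" by simp
  define A where "A = {0<..} - {x. poly p x = 0}"
  have fin: "finite {x. poly p x = 0}" using assms by (simp add: poly_roots_finite)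
  have cl: "closed {x. poly p x = 0}" using fin by (rule finite_imp_closed)
  then have A: "A \<in> sets lborel" by (auto simp: A_def)
  have "A \<in> null_sets lborel"
  proof (rule null_if_pos_func_has_zero_int)
    show "integrable lborel (\<lambda>x. indicator {0<..} x * (poly (p * p) x * weight c s x))"
      using integrable_poly_weight[OF assms(1,2), of "p * p"] by (simp add: set_integrable_def)
    show "AE x\<in>A in lborel. 0 < indicator {0<..} x * (poly (p * p) x * weight c s x)"
      by (intro AE_I2) (auto simp: A_def weight_def zero_less_mult_iff)
    have "(LINT x:A|lborel. indicator {0<..} x * (poly (p * p) x * weight c s x)) = lin c s (p * p)"
      unfolding lin_def set_lebesgue_integral_def
      by (rule Bochner_Integration.integral_cong) (auto simp: A_def indicator_def)
    then show "(LINT x:A|lborel. indicator {0<..} x * (poly (p * p) x * weight c s x)) = 0"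
      using z by simp
  qed (use A in auto)
  moreover have "{x. poly p x = 0} \<in> null_sets lborel"
    by (rule finite_imp_null_set_lborel) (rule fin)
  ultimately have "A \<union> {x. poly p x = 0} \<in> null_sets lborel" by auto
  then have "{1..2} \<in> null_sets (lborel :: real measure)"
    by (rule null_sets_subset) (auto simp: A_def)
  then show False by (simp add: null_sets_def)
qed

text \<open>This is the vanishing integral of the derivative of \<open>x p w\<close>. In the
  induction the constant term is \<open>mom_recurrence\<close>, and the rest, divisible by
  \<open>x\<close>, is the same identity at \<open>c + 1\<close>.\<close>

lemma lin_integration_by_parts:
  assumes "c > 0" "s \<ge> 0"
  shows "lin c s p + lin c s (pCons 0 (pderiv p)) - lin c s (pCons 0 p) + c * lin c s p
    + s * lin (c - 1) s p = 0"
  using assms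
proof (induction p arbitrary: c)
  case (pCons a p)
  have "lin (c + 1) s p + lin (c + 1) s (pCons 0 (pderiv p)) - lin (c + 1) s (pCons 0 p)
      + (c + 1) * lin (c + 1) s p + s * lin c s p = 0"
    using pCons.IH[of "c + 1"] pCons.prems by simp
  moreover have "a * ((c + 1) * mom c s - mom (c + 1) s + s * mom (c - 1) s) = 0"
    using mom_recurrence[of c s] pCons.prems by simp
  ultimately show ?case
    using pCons.prems by (simp add: pderiv_pCons lin_simps algebra_simps)
qed simp

text \<open>At \<open>s = 0\<close> the derivative of \<open>p w\<close> itself can be integrated,
  without the extra factor \<open>x\<close>: write \<open>p = a + x q\<close>, apply the previous
  identity to \<open>q\<close> and the moment recurrence to \<open>a\<close>.\<close>

lemma lin_integration_by_parts_zero: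
  assumes "c > 0"
  shows "lin c 0 (pderiv p) - lin c 0 p + c * lin (c - 1) 0 p = 0"
proof (cases p)
  case (pCons a q)
  have "c * mom (c - 1) 0 = mom c 0"
    using mom_recurrence[of "c - 1" 0] assms by simp
  with lin_integration_by_parts[of c 0 q] show ?thesis
    using assms pCons by (simp add: pderiv_pCons lin_simps algebra_simps)
qed

text \<open>Product rule in the finite moment sum: \<open>D\<close> collects the derivatives of the
  coefficients, and the term with \<open>c - 1\<close> comes from differentiating the
  weight.\<close>

lemma lin_has_derivative:
  assumes c: "c > 0" and s: "s > 0" and deg: "\<And>t. t > 0 \<Longrightarrow> degree (Q t) \<le> N"
    and der: "\<And>i. ((\<lambda>t. coeff (Q t) i) has_real_derivative coeff D i) (at s)" and degD: "degree D \<le> N"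
  shows "((\<lambda>t. lin c t (Q t)) has_real_derivative lin c s D - lin (c - 1) s (Q s)) (at s)"
proof -
  have "((\<lambda>t. \<Sum>i\<le>N. coeff (Q t) i * mom (c + real i) t) has_real_derivative
    (\<Sum>i\<le>N. coeff D i * mom (c + real i) s + coeff (Q s) i * - mom (c + real i - 1) s)) (at s)"
    using c s by (auto intro!: DERIV_sum derivative_eq_intros der mom_has_derivative simp: add_pos_nonneg)
  moreover have "(\<Sum>i\<le>N. coeff D i * mom (c + real i) s + coeff (Q s) i * - mom (c + real i - 1) s)
     = lin c s D - lin (c - 1) s (Q s)"
    using c s deg degD
    by (simp add: lin_eq_sum[of _ _ _ N] sum_subtractf algebra_simps)
  ultimately have "((\<lambda>t. \<Sum>i\<le>N. coeff (Q t) i * mom (c + real i) t) has_real_derivative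
      lin c s D - lin (c - 1) s (Q s)) (at s)" by simp
  then show ?thesis
  proof (rule has_field_derivative_transform_within_open)
    show "open {0::real<..}" "s \<in> {0<..}" using s by auto
    show "(\<Sum>i\<le>N. coeff (Q t) i * mom (c + real i) t) = lin c t (Q t)" if "t \<in> {0<..}" for t
      using that c deg by (intro lin_eq_sum[symmetric]) auto
  qed
qed

subsection \<open>Compatibility relations for fixed \<open>s\<close>\<close>

locale orthogonal_polys =
  fixes \<alpha> s :: real and P :: "nat \<Rightarrow> real poly" and h :: "nat \<Rightarrow> real"
  assumes alpha: "\<alpha> > 0" and s_nonneg: "s \<ge> 0" and ortho: "monic_orthogonal \<alpha> s P h"
begin

abbreviation "E \<equiv> lin \<alpha> s"
abbreviation "F \<equiv> lin (\<alpha> - 1) s"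

lemma degree_P [simp]: "degree (P n) = n"
  and coeff_P_top [simp]: "coeff (P n) n = 1"
  using ortho unfolding monic_orthogonal_def by (metis)+

lemma coeff_P_above [simp]: "k > n \<Longrightarrow> coeff (P n) k = 0"
  by (simp add: coeff_eq_0)

lemma P_nonzero [simp]: "P n \<noteq> 0"
  using coeff_P_top[of n] by force

lemma P_0: "P 0 = 1"
  using degree_P[of 0] coeff_P_top[of 0] by (metis degree_eq_zeroE coeff_pCons_0 one_pCons)

lemma E_P_P: "E (P j * P k) = (if j = k then h j else 0)"
  using ortho unfolding monic_orthogonal_def lin_def by simp

lemma h_pos: "h n > 0"
  using lin_square_pos[of \<alpha> s "P n"] E_P_P[of n n] alpha s_nonneg by simp

lemma E_add: "E (p + q) = E p + E q" and E_diff: "E (p - q) = E p - E q"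
  and F_add: "F (p + q) = F p + F q"
  using alpha s_nonneg by (simp_all add: lin_add lin_diff)

lemma F_X: "F (pCons 0 p) = E p"
  by (simp add: lin_X)

lemma E_P_lower: "degree q < n \<Longrightarrow> E (P n * q) = 0"
proof -
  have "degree q < m \<Longrightarrow> m \<le> n \<Longrightarrow> E (P n * q) = 0" for m
  proof (induction m arbitrary: q)
    case (Suc m)
    define r where "r = q - smult (coeff q m) (P m)"
    have "degree r \<le> m" using Suc.prems unfolding r_def
      by (intro degree_diff_le order_trans[OF degree_smult_le]) auto
    moreover have "coeff r m = 0" by (simp add: r_def)
    ultimately have "r = 0 \<or> degree r < m"
      by (metis le_neq_implies_less leading_coeff_0_iff)
    then have "E (P n * r) = 0" using Suc by auto
    moreover have "q = r + smult (coeff q m) (P m)" by (simp add: r_def)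
    ultimately show ?case
      using Suc.prems by (metis E_P_P E_add add_0 lin_smult mult_smult_right distrib_left
        mult_zero_right not_less_eq_eq order_refl)
  qed simp
  then show "degree q < n \<Longrightarrow> E (P n * q) = 0" by blast
qed

lemma E_P_top:
  assumes "degree q \<le> n" shows "E (P n * q) = coeff q n * h n"
proof -
  define r where "r = q - smult (coeff q n) (P n)"
  have "degree r \<le> n" using assms unfolding r_def
    by (intro degree_diff_le order_trans[OF degree_smult_le]) auto
  moreover have "coeff r n = 0" by (simp add: r_def)
  ultimately have "r = 0 \<or> degree r < n"
    by (metis le_neq_implies_less leading_coeff_0_iff)
  then have "E (P n * r) = 0" using E_P_lower by auto
  then show ?thesis by (simp add: r_def right_diff_distrib E_diff lin_smult E_P_P)
qed

lemma eq_0_if_orthogonal: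
  assumes "\<And>k. k \<le> degree q \<Longrightarrow> E (P k * q) = 0"
  shows "q = 0"
  using E_P_top[of q "degree q"] assms[of "degree q"] h_pos[of "degree q"] by simp

text \<open>
  \<open>subleading n\<close> is the coefficient of \<open>x ^ (n - 1)\<close> in \<open>P n\<close>, and \<open>0\<close> for \<open>n = 0\<close>; the latter, as
  well as \<open>rec\<beta> 0 = b 0 = 0\<close>, lets the recurrences below hold for all \<open>n\<close> although \<open>0 - 1 = 0\<close>.
\<close>
definition "subleading n = coeff (pCons 0 (P n)) n"
definition "rec\<alpha> n = subleading n - subleading (Suc n)"
definition "rec\<beta> n = (case n of 0 \<Rightarrow> 0 | Suc m \<Rightarrow> h n / h m)"
definition "a n = s * F (P n * P n) / h n"
definition "b n = (case n of 0 \<Rightarrow> 0 | Suc m \<Rightarrow> s * F (P n * P m) / h m)"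

lemma subleading_0 [simp]: "subleading 0 = 0" and subleading_Suc [simp]: "subleading (Suc n) = coeff (P (Suc n)) n"
  by (simp_all add: subleading_def)

text \<open>The choice of \<open>rec\<alpha>\<close> cancels the coefficient of degree
  \<open>n\<close>. Against \<open>P k\<close> with \<open>k < n\<close>, moving \<open>x\<close>
  onto \<open>P k\<close> leaves only \<open>k = n - 1\<close>, where \<open>rec\<beta>\<close>
  cancels the rest.\<close>

lemma three_term: "pCons 0 (P n) = P (Suc n) + smult (rec\<alpha> n) (P n) + smult (rec\<beta> n) (P (n - 1))"
proof -
  define Q where "Q = pCons 0 (P n) - P (Suc n) - smult (rec\<alpha> n) (P n) - smult (rec\<beta> n) (P (n - 1))"
  have c: "coeff Q k = 0" if k: "k \<ge> n" for k
  proof -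
    consider "k = n" | "k = Suc n" | "k > Suc n" using k by linarith
    then show ?thesis
    proof cases
      case 1
      then show ?thesis
        by (cases n) (simp_all add: Q_def rec\<alpha>_def rec\<beta>_def)
    qed (simp_all add: Q_def coeff_pCons split: nat.splits)
  qed
  have d: "degree Q \<le> n" by (rule degree_le) (use c in auto)
  have "Q = 0"
  proof (rule eq_0_if_orthogonal)
    fix k assume "k \<le> degree Q"
    with d have "k \<le> n" by simp
    show "E (P k * Q) = 0"
    proof (cases "k = n")
      case True
      then show ?thesis using E_P_top[OF d] c by simp
    next
      case False
      with \<open>k \<le> n\<close> obtain m where n: "n = Suc m" and k: "k \<le> m" by (cases n) auto
      have "E (P k * pCons 0 (P n)) = E (P n * pCons 0 (P k))" by (simp add: mult.commute)
      also have "\<dots> = (if k = m then h n else 0)"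
        using k n by (subst E_P_top) (auto simp: coeff_P_above)
      finally show ?thesis
        using k n h_pos[of m] unfolding Q_def right_diff_distrib E_diff
        by (simp add: E_P_P lin_smult rec\<beta>_def)
    qed
  qed
  then show ?thesis by (simp add: Q_def algebra_simps)
qed

section \<open>Relations from integration by parts and from division by \<open>x\<close>\<close>

lemma integration_by_parts:
  "(1 + \<alpha>) * E p + E (pCons 0 (pderiv p)) - E (pCons 0 p) + s * F p = 0"
  using lin_integration_by_parts[of \<alpha> s p] alpha s_nonneg by (simp add: algebra_simps)

text \<open>Integrate by parts against \<open>P n * P n\<close>: the coefficient of degree
  \<open>n\<close> in \<open>x P\<^sub>n'\<close> is \<open>n\<close>, and the recurrence evaluates
  \<open>E (x P\<^sub>n P\<^sub>n)\<close> as \<open>rec\<alpha> n * h n\<close>.\<close>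

lemma rec\<alpha>_eq: "rec\<alpha> n = 2 * real n + 1 + \<alpha> + a n"
proof -
  have "degree (pCons 0 (pderiv (P n))) \<le> n"
    by (cases n) (auto simp: degree_pderiv P_0)
  then have "E (P n * pCons 0 (pderiv (P n))) = real n * h n"
    by (subst E_P_top) (auto simp: coeff_pCons coeff_pderiv split: nat.splits)
  moreover have "pCons 0 (pderiv (P n * P n)) = P n * pCons 0 (pderiv (P n)) + P n * pCons 0 (pderiv (P n))"
    by (simp add: pderiv_mult)
  ultimately have 1: "E (pCons 0 (pderiv (P n * P n))) = 2 * real n * h n"
    by (simp only: E_add)
  have "E (pCons 0 (P n * P n)) = E (P n * pCons 0 (P n))" by simp
  also have "\<dots> = rec\<alpha> n * h n"
    unfolding three_term by (simp add: distrib_left E_add E_P_P lin_smult rec\<beta>_def split: nat.splits)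
  finally have "rec\<alpha> n * h n = (2 * real n + 1 + \<alpha>) * h n + s * F (P n * P n)"
    using integration_by_parts[of "P n * P n"] 1 by (simp add: E_P_P algebra_simps)
  then show ?thesis using h_pos[of n] by (simp add: a_def field_simps)
qed

text \<open>Write \<open>q = q(0) + x r\<close>. Since \<open>F (x p) = E p\<close>, orthogonality
  removes the part with \<open>r\<close>, which is zero or of degree below \<open>n\<close>.\<close>

lemma F_P:
  assumes "degree q \<le> n" shows "F (P n * q) = poly q 0 * F (P n)"
proof (cases q)
  case (pCons c r)
  have "r = 0 \<or> degree r < n" using assms pCons by (auto split: if_splits)
  then have "E (P n * r) = 0" using E_P_lower by auto
  then show ?thesis using pCons by (simp add: F_add lin_smult F_X)
qed

text \<open>One degree above the range of \<open>F_P\<close>, the quotient by \<open>x\<close> is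
  monic of degree \<open>m\<close> and contributes \<open>h m\<close>.\<close>

lemma F_P_Suc: "F (P m * P (Suc m)) = poly (P (Suc m)) 0 * F (P m) + h m"
proof (cases "P (Suc m)")
  case (pCons c r)
  then have r: "degree r = m" "coeff r m = 1"
    using degree_P[of "Suc m"] coeff_P_top[of "Suc m"] by (auto split: if_splits)
  then have "E (P m * r) = h m" by (simp add: E_P_top)
  then show ?thesis using pCons by (simp add: F_add lin_smult F_X)
qed

text \<open>
  Up to the factor \<open>s / h (n - 1)\<close>, both \<open>b n\<close> and \<open>b n - s\<close> have the form \<open>P j 0 * F (P k)\<close> with
  \<open>{j, k} = {n - 1, n}\<close>, by \<open>F_P\<close> and \<open>F_P_Suc\<close>.
\<close>
lemma b_relation: "b n ^ 2 - s * b n = rec\<beta> n * a n * a (n - 1)"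
proof (cases n)
  case (Suc m)
  define x where "x = F (P n * P m)"
  have 1: "x = poly (P m) 0 * F (P n)" by (simp add: x_def F_P Suc)
  have 2: "x - h m = poly (P n) 0 * F (P m)" using F_P_Suc[of m] by (simp add: x_def Suc mult.commute)
  \<comment> \<open>Regrouping the product pairs \<open>poly (P n) 0\<close> with
    \<open>F (P n)\<close> and likewise for \<open>m\<close>; \<open>F_P\<close> reads each pair as
    the integral of a square.\<close>
  have "x * (x - h m) = F (P n * P n) * F (P m * P m)"
    unfolding F_P[OF eq_refl[OF degree_P]] by (simp add: 1 flip: 2)
  moreover have "rec\<beta> n * a n * a (n - 1) = s\<^sup>2 * (F (P n * P n) * F (P m * P m)) / (h m)\<^sup>2"
    using h_pos[of n] Suc by (simp add: a_def rec\<beta>_def power2_eq_square)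
  moreover have b: "b n = s * x / h m" by (simp add: b_def x_def Suc)
  have "b n ^ 2 - s * b n = s\<^sup>2 * (x * (x - h m)) / (h m)\<^sup>2"
    unfolding b using h_pos[of m] by (simp add: power2_eq_square field_simps)
  ultimately show ?thesis by simp
qed (simp add: b_def rec\<beta>_def)

lemma b_Suc_add: "b (Suc n) + b n = s - rec\<alpha> n * a n"
proof -
  have "h n = F (pCons 0 (P n) * P n)" by (simp add: F_X E_P_P)
  also have "\<dots> = F (P (Suc n) * P n) + rec\<alpha> n * F (P n * P n) + rec\<beta> n * F (P n * P (n - 1))"
    unfolding three_term by (simp add: distrib_left distrib_right F_add lin_smult mult.commute)
  finally have "s = s * (F (P (Suc n) * P n) + rec\<alpha> n * F (P n * P n) + rec\<beta> n * F (P n * P (n - 1))) / h n"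
    using h_pos[of n] by simp
  also have "\<dots> = b (Suc n) + rec\<alpha> n * a n + b n"
    using h_pos[of n] by (cases n) (simp_all add: b_def a_def rec\<beta>_def distrib_left add_divide_distrib)
  finally show ?thesis by simp
qed

text \<open>Expanding \<open>x P\<^sub>n\<close> in the vanishing integral
  \<open>F (x P\<^sub>n P\<^sub>n\<^sub>+\<^sub>1)\<close> and in
  \<open>F (x P\<^sub>n P\<^sub>n\<^sub>-\<^sub>1) = 0\<close> produces
  \<open>F (P\<^sub>n\<^sub>+\<^sub>1 P\<^sub>n\<^sub>-\<^sub>1)\<close> in both; it is then
  eliminated.\<close>

lemma rec\<beta>_Suc_a:
  "rec\<beta> (Suc n) * a (Suc n) - rec\<beta> n * a (n - 1) = - rec\<alpha> n * (b (Suc n) - b n)"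
proof -
  have 1: "F (P (Suc n) * P (Suc n)) + rec\<alpha> n * F (P (Suc n) * P n) + rec\<beta> n * F (P (Suc n) * P (n - 1)) = 0"
  proof -
    have "0 = F (pCons 0 (P n) * P (Suc n))" by (simp add: F_X E_P_P)
    then show ?thesis
      unfolding three_term by (simp add: distrib_left distrib_right F_add lin_smult mult.commute)
  qed
  have 2: "F (P (Suc n) * P m) + rec\<alpha> n * F (P n * P m) + rec\<beta> n * F (P m * P m) = 0" if n: "n = Suc m" for m
  proof -
    have "0 = F (pCons 0 (P n) * P m)" by (simp add: F_X E_P_P n)
    then show ?thesis
      unfolding three_term by (simp add: distrib_left distrib_right F_add lin_smult mult.commute n)
  qed
  show ?thesis
  proof (cases n)
    case 0
    then have "F (P (Suc n) * P (Suc n)) = - (rec\<alpha> n * F (P (Suc n) * P n))"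
      using 1 by (simp add: rec\<beta>_def)
    then show ?thesis using 0 h_pos[of 0] h_pos[of "Suc 0"]
      by (simp add: rec\<beta>_def b_def a_def)
  next
    case (Suc m)
    have "F (P (Suc n) * P (Suc n)) + rec\<alpha> n * F (P (Suc n) * P n)
      = rec\<beta> n * (rec\<alpha> n * F (P n * P m) + rec\<beta> n * F (P m * P m))"
    proof -
      have "rec\<alpha> n * F (P n * P m) + rec\<beta> n * F (P m * P m) = - F (P (Suc n) * P m)"
        using 2[OF Suc] by simp
      then show ?thesis using 1 Suc by simp
    qed
    then have "s / h n * (F (P (Suc n) * P (Suc n)) + rec\<alpha> n * F (P (Suc n) * P n))
      = s / h n * (rec\<beta> n * (rec\<alpha> n * F (P n * P m) + rec\<beta> n * F (P m * P m)))" by simp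
    moreover have "s / h n * (rec\<beta> n * (rec\<alpha> n * F (P n * P m) + rec\<beta> n * F (P m * P m)))
      = rec\<alpha> n * b n + rec\<beta> n * a m"
      using h_pos[of n] h_pos[of m] by (simp add: rec\<beta>_def b_def a_def Suc field_simps)
    moreover have "s / h n * (F (P (Suc n) * P (Suc n)) + rec\<alpha> n * F (P (Suc n) * P n))
      = rec\<beta> (Suc n) * a (Suc n) + rec\<alpha> n * b (Suc n)"
      using h_pos[of n] h_pos[of "Suc n"] by (simp add: rec\<beta>_def b_def a_def field_simps)
    ultimately show ?thesis using Suc by (simp add: algebra_simps)
  qed
qed

text \<open>Integrate by parts against \<open>P n * P (n - 1)\<close>. In \<open>r\<close>,
  subtracting \<open>n P\<^sub>n\<close> from \<open>x P\<^sub>n'\<close> cancels the top term, so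
  only the next coefficient, \<open>- subleading n\<close>, survives against
  \<open>P m\<close>.\<close>

lemma rec\<beta>_eq: "rec\<beta> n = b n - subleading n"
proof (cases n)
  case (Suc m)
  define r where "r = pCons 0 (pderiv (P n)) - smult (real n) (P n)"
  have c: "coeff r k = (real k - real n) * coeff (P n) k" for k
    by (cases k) (simp_all add: r_def coeff_pderiv algebra_simps)
  have "degree r \<le> m" by (rule degree_le) (auto simp: c Suc,
    metis coeff_P_above Suc_lessI diff_self mult_zero_left of_nat_eq_iff right_minus_eq of_nat_Suc Suc)
  then have "E (P m * r) = - subleading n * h m"
    by (simp add: E_P_top c Suc)
  then have 1: "E (P m * pCons 0 (pderiv (P n))) = - subleading n * h m"
    by (simp add: r_def right_diff_distrib E_diff lin_smult E_P_P Suc)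
  have "degree (pCons 0 (pderiv (P m))) < n"
    using Suc by (cases m) (auto simp: degree_pderiv P_0)
  then have 2: "E (P n * pCons 0 (pderiv (P m))) = 0" by (rule E_P_lower)
  have 3: "E (pCons 0 (P n * P m)) = h n"
    using E_P_top[of "pCons 0 (P m)" n] Suc by (simp add: degree_pCons_eq_if)
  have "pCons 0 (pderiv (P n * P m)) = P m * pCons 0 (pderiv (P n)) + P n * pCons 0 (pderiv (P m))"
    by (simp add: pderiv_mult)
  then have "E (pCons 0 (pderiv (P n * P m))) = - subleading n * h m"
    using 1 2 by (simp only: E_add)
  then have "s * F (P n * P m) = h n + subleading n * h m"
    using integration_by_parts[of "P n * P m"] 3 by (simp add: E_P_P Suc)
  then show ?thesis using h_pos[of m] Suc by (simp add: b_def rec\<beta>_def field_simps)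
qed (simp add: b_def rec\<beta>_def)

text \<open>In the induction step the increment becomes linear in \<open>b\<close> because
  \<open>a n - rec\<alpha> n\<close> is a constant and \<open>rec\<alpha> n * a n\<close> equals
  \<open>s - (b (Suc n) + b n)\<close>.\<close>

lemma rec\<beta>_a_sum: "rec\<beta> n * (a n + a (n - 1)) = real n * s - (2 * real n + \<alpha>) * b n"
proof (induction n)
  case (Suc n)
  have 1: "rec\<beta> (Suc n) - rec\<beta> n = b (Suc n) - b n + rec\<alpha> n"
    by (simp add: rec\<beta>_eq rec\<alpha>_def)
  have "rec\<beta> (Suc n) * (a (Suc n) + a n) = rec\<beta> (Suc n) * a (Suc n) - rec\<beta> n * a (n - 1)
     + (rec\<beta> (Suc n) - rec\<beta> n) * a n + rec\<beta> n * (a n + a (n - 1))"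
    by (simp add: algebra_simps)
  also have "\<dots> = - rec\<alpha> n * (b (Suc n) - b n) + (b (Suc n) - b n + rec\<alpha> n) * a n
      + (real n * s - (2 * real n + \<alpha>) * b n)"
    unfolding rec\<beta>_Suc_a 1 Suc.IH ..
  also have "\<dots> = (a n - rec\<alpha> n) * (b (Suc n) - b n) + rec\<alpha> n * a n + (real n * s - (2 * real n + \<alpha>) * b n)"
    by (simp add: algebra_simps)
  also have "\<dots> = - (2 * real n + 1 + \<alpha>) * (b (Suc n) - b n) + (s - (b (Suc n) + b n))
     + (real n * s - (2 * real n + \<alpha>) * b n)"
    using b_Suc_add[of n] rec\<alpha>_eq[of n] by simp
  finally show ?case by (simp add: algebra_simps)
qed (simp add: rec\<beta>_def b_def)

lemma a_pos: "s > 0 \<Longrightarrow> a n > 0"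
  using lin_square_pos[of "\<alpha> - 1" s "P n"] h_pos[of n] alpha by (simp add: a_def)

lemma a_eq_aux_a: "s / h n * (LBINT y:{0<..}. (poly (P n) y)\<^sup>2 / y * weight \<alpha> s y) = a n"
proof -
  have "(LBINT y:{0<..}. (poly (P n) y)\<^sup>2 / y * weight \<alpha> s y) = F (P n * P n)"
    unfolding lin_def by (intro set_lebesgue_integral_cong) (auto simp: weight_diff1 power2_eq_square)
  then show ?thesis by (simp add: a_def)
qed

lemma E_sum: "E (\<Sum>k\<in>A. f k) = (\<Sum>k\<in>A. E (f k))"
  by (induction A rule: infinite_finite_induct) (simp_all add: E_add)

text \<open>Nothing is assumed on how \<open>P n\<close> depends on \<open>s\<close>; this formula,
  recursive in \<open>n\<close>, reduces that dependence to the moments.\<close>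

lemma gram_schmidt:
  "P n = monom 1 n - (\<Sum>k<n. smult (E (monom 1 n * P k) / h k) (P k))"
proof -
  define D where "D = P n - (monom 1 n - (\<Sum>k<n. smult (E (monom 1 n * P k) / h k) (P k)))"
  have c: "coeff D k = 0" if "k \<ge> n" for k
    using that by (cases "k = n") (auto simp: D_def coeff_sum)
  have "D = 0"
  proof (rule eq_0_if_orthogonal)
    fix k assume k: "k \<le> degree D"
    show "E (P k * D) = 0"
    proof (cases "k < n")
      case True
      have "(\<Sum>j<n. E (P k * smult (E (monom 1 n * P j) / h j) (P j)))
        = (\<Sum>j<n. if j = k then E (monom 1 n * P k) else 0)"
        using h_pos[of k] by (intro sum.cong) (auto simp: lin_smult E_P_P)
      also have "\<dots> = E (monom 1 n * P k)" using True by simp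
      finally show ?thesis using True unfolding D_def right_diff_distrib E_diff sum_distrib_left E_sum
        by (simp add: E_P_P mult.commute)
    next
      case False
      with k have "coeff D (degree D) = 0" by (intro c) simp
      then show ?thesis by simp
    qed
  qed
  then show ?thesis by (simp add: D_def)
qed

end

subsection \<open>Dependence on \<open>s\<close>\<close>

text \<open>
  An abstract class of functions on \<open>[0, \<infinity>)\<close>, instantiated below both by differentiability at a
  positive point and by right continuity at \<open>0\<close>.
\<close>
locale function_class =
  fixes R :: "(real \<Rightarrow> real) \<Rightarrow> bool"
  assumes const: "R (\<lambda>_. c)"
    and add: "R f \<Longrightarrow> R g \<Longrightarrow> R (\<lambda>s. f s + g s)"
    and mult: "R f \<Longrightarrow> R g \<Longrightarrow> R (\<lambda>s. f s * g s)"
    and inverse: "R f \<Longrightarrow> (\<And>s. s \<ge> 0 \<Longrightarrow> f s > 0) \<Longrightarrow> R (\<lambda>s. inverse (f s))"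
    and cong: "R f \<Longrightarrow> (\<And>s. s \<ge> 0 \<Longrightarrow> f s = g s) \<Longrightarrow> R g"
begin

lemma sum: "(\<And>k. k \<in> A \<Longrightarrow> R (f k)) \<Longrightarrow> R (\<lambda>s. \<Sum>k\<in>A. f k s)"
  by (induction A rule: infinite_finite_induct) (auto intro: const add)

lemma coeff_mult_closed:
  assumes "\<And>i. R (\<lambda>s. coeff (p s) i)" "\<And>i. R (\<lambda>s. coeff (q s) i)"
  shows "R (\<lambda>s. coeff (p s * q s) i)"
  unfolding coeff_mult by (intro sum mult assms)

lemma lin_closed:
  assumes "c > -1" and "\<And>i. R (mom (c + real i))"
    and "\<And>s. s \<ge> 0 \<Longrightarrow> degree (Q s) \<le> N" and "\<And>i. R (\<lambda>s. coeff (Q s) i)"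
  shows "R (\<lambda>s. lin c s (Q s))"
proof (rule cong)
  show "R (\<lambda>s. \<Sum>i\<le>N. coeff (Q s) i * mom (c + real i) s)"
    by (intro sum mult assms)
qed (rule lin_eq_sum[symmetric], use assms in auto)

end

text \<open>Agreement for \<open>s \<ge> 0\<close> suffices in \<open>cong\<close>, as
  \<open>t\<close> is interior to that half-line; the families below are unconstrained for negative
  \<open>s\<close>.\<close>

lemma function_class_differentiable:
  assumes "t > 0" shows "function_class (\<lambda>f. f differentiable at t)"
proof
  show "(\<lambda>s. inverse (f s)) differentiable at t"
    if "f differentiable at t" "\<And>s. s \<ge> 0 \<Longrightarrow> f s > 0" for f :: "real \<Rightarrow> real"
    using that(1) that(2)[of t] assms by (intro differentiable_inverse) auto
  show "g differentiable at t" if f: "f differentiable at t" and eq: "\<And>s. s \<ge> 0 \<Longrightarrow> f s = g s" for f g :: "real \<Rightarrow> real"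
  proof -
    obtain d where d: "(f has_real_derivative d) (at t)" using f by (auto simp: real_differentiable_def)
    have "(g has_real_derivative d) (at t)"
      by (rule has_field_derivative_transform_within_open[OF d, of "{0<..}"]) (use assms eq in auto)
    then show ?thesis by (auto simp: real_differentiable_def)
  qed
qed auto

lemma function_class_continuous:
  "function_class (\<lambda>f. continuous (at 0 within {0..}) f)"
proof
  show "continuous (at 0 within {0..}) (\<lambda>s. inverse (f s))"
    if "continuous (at 0 within {0..}) f" "\<And>s. s \<ge> 0 \<Longrightarrow> f s > 0" for f :: "real \<Rightarrow> real"
    using that(1) that(2)[of 0] by (intro continuous_at_within_inverse) auto
  show "continuous (at 0 within {0..}) g"
    if "continuous (at 0 within {0..}) f" "\<And>s. s \<ge> 0 \<Longrightarrow> f s = g s" for f g :: "real \<Rightarrow> real"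
    using that(1) by (rule continuous_transform_within[of _ _ _ 1]) (use that(2) in auto)
qed (auto intro: continuous_intros)

text \<open>Here \<open>x\<close>, \<open>y\<close>, \<open>m\<close> stand for
  \<open>a\<^sub>n\<close>, \<open>b\<^sub>n\<close>, \<open>n\<close>, and the left side is the
  quotient-rule derivative of the formula for \<open>a'\<close>. That formula, solved for
  \<open>y\<close>, eliminates \<open>y\<close> from the one for \<open>b'\<close>.\<close>

lemma painleve_identity:
  fixes s x y L a' b' m \<alpha> :: real
  assumes "s > 0" "x > 0" "a' = (2 * y - s + (L + x) * x) / s"
    "b' = (2 * (y ^ 2 - s * y) / x + L * y - m * s) / s" "L = 2 * m + 1 + \<alpha>"
  shows "((2 * b' - 1 + ((L + x) * a' + a' * x)) * s - (2 * y - s + (L + x) * x) * 1) / (s * s)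
    = a'\<^sup>2 / x - a' / s + L * x\<^sup>2 / s\<^sup>2 + x ^ 3 / s\<^sup>2 + \<alpha> / s - 1 / x"
proof -
  have y: "2 * y = s * a' + s - (L + x) * x" using assms(1,3) by (simp add: field_simps)
  \<comment> \<open>Completing the square in \<open>4 * (y\<^sup>2 - s * y)\<close> leaves only the
    combination \<open>2 * y\<close>, known from \<open>a'\<close>.\<close>
  have "2 * b' * s * x = (2 * y - s)\<^sup>2 - s\<^sup>2 + L * (2 * y) * x - 2 * m * s * x"
    using assms(1,2) unfolding assms(4) by (simp add: field_simps power2_eq_square)
  also have "\<dots> = (s * a' - (L + x) * x)\<^sup>2 - s\<^sup>2 + L * (s * a' + s - (L + x) * x) * x - 2 * m * s * x"
    unfolding y by simp
  finally have b': "2 * b' * s * x = \<dots>" .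
  define X where "X = (2 * b' - 1 + ((L + x) * a' + a' * x)) * s - (2 * y - s + (L + x) * x) * 1"
  have "x * X = 2 * b' * s * x + x * ((- 1 + ((L + x) * a' + a' * x)) * s - s * a')"
    unfolding X_def y by (simp add: algebra_simps)
  also have "\<dots> = s\<^sup>2 * a'\<^sup>2 - x * s * a' + L * x ^ 3 + x ^ 4 + \<alpha> * s * x - s\<^sup>2"
    unfolding b' assms(5) by (simp add: algebra_simps power2_eq_square power3_eq_cube power4_eq_xxxx)
  finally have X: "X = (s\<^sup>2 * a'\<^sup>2 - x * s * a' + L * x ^ 3 + x ^ 4 + \<alpha> * s * x - s\<^sup>2) / x"
    using assms(2) by (simp add: field_simps)
  show ?thesis
    unfolding X_def[symmetric] X using assms(1,2)
    by (simp add: field_simps power2_eq_square power3_eq_cube power4_eq_xxxx)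
qed

section \<open>Regularity and derivatives in \<open>s\<close> of the orthogonal family\<close>

locale orthogonal_family =
  fixes \<alpha> :: real and P :: "nat \<Rightarrow> real \<Rightarrow> real poly" and h :: "nat \<Rightarrow> real \<Rightarrow> real"
  assumes alpha: "\<alpha> > 0"
    and ortho: "s \<ge> 0 \<Longrightarrow> monic_orthogonal \<alpha> s (\<lambda>k. P k s) (\<lambda>k. h k s)"
begin

lemma fixed: "s \<ge> 0 \<Longrightarrow> orthogonal_polys \<alpha> s (\<lambda>k. P k s) (\<lambda>k. h k s)"
  using alpha ortho by unfold_locales

lemmas degree_P = orthogonal_polys.degree_P[OF fixed]
lemmas h_pos = orthogonal_polys.h_pos[OF fixed]

text \<open>Gram--Schmidt expresses everything rationally in the moments.\<close>
lemma coefficients_closed: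
  assumes "function_class R" and mom: "\<And>i. R (mom (\<alpha> + real i))"
  shows "R (\<lambda>s. coeff (P n s) i)" and "R (h n)"
proof -
  interpret function_class R by fact
  \<comment> \<open>Conditional on the coefficients, so that the strong induction below can use it
    for each \<open>k < n\<close>.\<close>
  have hR: "R (h n)" if "\<And>i. R (\<lambda>s. coeff (P n s) i)" for n
  proof (rule cong)
    show "R (\<lambda>s. lin \<alpha> s (P n s * P n s))"
      using alpha by (intro lin_closed[where N = "n + n"] coeff_mult_closed mom that
        order_trans[OF degree_mult_le]) (auto simp: degree_P)
  qed (simp add: orthogonal_polys.E_P_P[OF fixed])
  have PR: "R (\<lambda>s. coeff (P n s) i)" for n i
  proof (induction n arbitrary: i rule: less_induct)
    case (less n)
    let ?c = "\<lambda>k s. lin \<alpha> s (monom 1 n * P k s) * inverse (h k s)"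
    have "R (\<lambda>s. coeff (monom 1 n) i + (\<Sum>k<n. -1 * (?c k s * coeff (P k s) i)))"
    proof (intro add sum mult inverse const hR less.IH)
      show "R (\<lambda>s. lin \<alpha> s (monom 1 n * P k s))" if "k \<in> {..<n}" for k
        using alpha that by (intro lin_closed[where N = "n + n"] coeff_mult_closed mom less.IH const
          order_trans[OF degree_mult_le]) (auto simp: degree_P degree_monom_eq)
    qed (auto simp: h_pos)
    then show ?case
    proof (rule cong)
      fix s :: real assume "s \<ge> 0"
      then show "coeff (monom 1 n) i + (\<Sum>k<n. -1 * (?c k s * coeff (P k s) i)) = coeff (P n s) i"
        by (subst orthogonal_polys.gram_schmidt[OF fixed, of s n])
           (simp_all add: coeff_sum sum_negf divide_inverse)
    qed
  qed
  show "R (\<lambda>s. coeff (P n s) i)" by (rule PR)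
  show "R (h n)" by (rule hR) (rule PR)
qed

text \<open>Being monic of degree \<open>n\<close> for all \<open>t > 0\<close> freezes the
  coefficients from index \<open>n\<close> upwards, so the derivative \<open>D\<close> has only
  lower terms.\<close>

lemma P_derivative:
  assumes s: "s > 0"
  obtains D where "\<And>i. ((\<lambda>t. coeff (P n t) i) has_real_derivative coeff D i) (at s)"
    and "\<And>i. i \<ge> n \<Longrightarrow> coeff D i = 0"
proof
  let ?d = "\<lambda>i. deriv (\<lambda>t. coeff (P n t) i) s"
  define D where "D = (\<Sum>i<n. monom (?d i) i)"
  have cD: "coeff D i = (if i < n then ?d i else 0)" for i
    by (simp add: D_def coeff_sum)
  show "((\<lambda>t. coeff (P n t) i) has_real_derivative coeff D i) (at s)" for i
  proof (cases "i < n")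
    case True
    have "mom (\<alpha> + real i) differentiable at s" for i
      using mom_has_derivative[of "\<alpha> + real i" s] alpha s by (auto simp: real_differentiable_def)
    then have "(\<lambda>t. coeff (P n t) i) differentiable at s"
      by (rule coefficients_closed[OF function_class_differentiable[OF s]])
    then show ?thesis using True by (simp add: cD DERIV_deriv_iff_real_differentiable)
  next
    case False
    have "((\<lambda>t. of_bool (i = n)) has_real_derivative 0) (at s)" by simp
    then have "((\<lambda>t. coeff (P n t) i) has_real_derivative 0) (at s)"
    proof (rule has_field_derivative_transform_within_open[of _ _ _ "{0<..}"])
      show "of_bool (i = n) = coeff (P n t) i" if "t \<in> {0<..}" for t
        using that False orthogonal_polys.coeff_P_top[OF fixed, of t n]
          orthogonal_polys.coeff_P_above[OF fixed, of t n i] by auto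
    qed (use s in auto)
    then show ?thesis using False by (simp add: cD)
  qed
  show "coeff D i = 0" if "i \<ge> n" for i using that by (simp add: cD)
qed

lemma lin_P_derivative:
  assumes s: "s > 0" and D: "\<And>i. ((\<lambda>t. coeff (P n t) i) has_real_derivative coeff D i) (at s)"
    "\<And>i. i \<ge> n \<Longrightarrow> coeff D i = 0" and q: "degree q \<le> n"
  shows "((\<lambda>t. lin \<alpha> t (P n t * q)) has_real_derivative
    lin \<alpha> s (D * q) - lin (\<alpha> - 1) s (P n s * q)) (at s)"
proof (rule lin_has_derivative[where N = "n + n"])
  have "degree D \<le> n" by (rule degree_le) (use D(2) in auto)
  then show "degree (D * q) \<le> n + n" using q by (intro order_trans[OF degree_mult_le]) auto
  show "degree (P n t * q) \<le> n + n" if "t > 0" for t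
    using q that by (intro order_trans[OF degree_mult_le]) (auto simp: degree_P)
  show "((\<lambda>t. coeff (P n t * q) i) has_real_derivative coeff (D * q) i) (at s)" for i
    unfolding coeff_mult by (auto intro!: DERIV_sum derivative_eq_intros D)
qed (use alpha s in auto)

text \<open>
  Here and in \<open>subleading_derivative\<close>, one factor is frozen at \<open>s\<close>: orthogonality makes the
  integral independent of it, so only the derivative of \<open>P n t\<close>, of degree below \<open>n\<close>, enters.
\<close>
lemma h_derivative:
  assumes s: "s > 0"
  shows "(h n has_real_derivative - lin (\<alpha> - 1) s (P n s * P n s)) (at s)"
proof -
  interpret s: orthogonal_polys \<alpha> s "\<lambda>k. P k s" "\<lambda>k. h k s" by (rule fixed) (use s in simp)
  obtain D where D: "\<And>i. ((\<lambda>t. coeff (P n t) i) has_real_derivative coeff D i) (at s)"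
    "\<And>i. i \<ge> n \<Longrightarrow> coeff D i = 0"
    using P_derivative[OF s] by blast
  have "degree D \<le> n" by (rule degree_le) (use D(2) in auto)
  then have "lin \<alpha> s (D * P n s) = 0"
    using s.E_P_top[of D n] D(2) by (simp add: mult.commute)
  with lin_P_derivative[OF s D, of "P n s"]
  have "((\<lambda>t. lin \<alpha> t (P n t * P n s)) has_real_derivative - lin (\<alpha> - 1) s (P n s * P n s)) (at s)"
    by simp
  then show ?thesis
  proof (rule has_field_derivative_transform_within_open[of _ _ _ "{0<..}"])
    show "lin \<alpha> t (P n t * P n s) = h n t" if "t \<in> {0<..}" for t
      using orthogonal_polys.E_P_top[OF fixed, of t "P n s" n] that by simp
  qed (use s in auto)
qed

abbreviation "sub n t \<equiv> orthogonal_polys.subleading (\<lambda>k. P k t) n"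
abbreviation "a n t \<equiv> orthogonal_polys.a \<alpha> t (\<lambda>k. P k t) (\<lambda>k. h k t) n"
abbreviation "b n t \<equiv> orthogonal_polys.b \<alpha> t (\<lambda>k. P k t) (\<lambda>k. h k t) n"
abbreviation "\<beta> n t \<equiv> orthogonal_polys.rec\<beta> (\<lambda>k. h k t) n"

lemma subleading_derivative:
  assumes s: "s > 0"
  shows "(sub n has_real_derivative b n s / s) (at s)"
proof -
  interpret s: orthogonal_polys \<alpha> s "\<lambda>k. P k s" "\<lambda>k. h k s" by (rule fixed) (use s in simp)
  show ?thesis
  proof (cases n)
    case 0
    have "((\<lambda>_. 0) has_real_derivative 0) (at s)" by simp
    then have "(sub 0 has_real_derivative 0) (at s)"
      by (rule has_field_derivative_transform_within_open[of _ _ _ "{0<..}"])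
         (use s orthogonal_polys.subleading_0[OF fixed] in auto)
    then show ?thesis by (simp add: 0 s.b_def)
  next
    case (Suc m)
    obtain D where D: "\<And>i. ((\<lambda>t. coeff (P n t) i) has_real_derivative coeff D i) (at s)"
      "\<And>i. i \<ge> n \<Longrightarrow> coeff D i = 0"
      using P_derivative[OF s] by blast
    have "degree D \<le> m" by (rule degree_le) (use D(2) Suc in auto)
    then have E: "lin \<alpha> s (D * P m s) = coeff D m * h m s"
      using s.E_P_top[of D m] by (simp add: mult.commute)
    have "((\<lambda>t. lin \<alpha> t (P n t * P m s)) has_real_derivative
        coeff D m * h m s - lin (\<alpha> - 1) s (P n s * P m s)) (at s)"
      using lin_P_derivative[OF s D, of "P m s"] Suc E by simp
    \<comment> \<open>The integral is zero for every \<open>t > 0\<close>; uniqueness of its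
      derivative then gives the value of \<open>coeff D m\<close>, the derivative of the subleading
      coefficient.\<close>
    then have "((\<lambda>_. 0) has_real_derivative coeff D m * h m s - lin (\<alpha> - 1) s (P n s * P m s)) (at s)"
    proof (rule has_field_derivative_transform_within_open[of _ _ _ "{0<..}"])
      show "lin \<alpha> t (P n t * P m s) = 0" if "t \<in> {0<..}" for t
        using orthogonal_polys.E_P_lower[OF fixed, of t "P m s" n] that Suc by simp
    qed (use s in auto)
    from DERIV_unique[OF this DERIV_const] have "coeff D m = b n s / s"
      using s.h_pos[of m] s by (simp add: s.b_def Suc field_simps)
    moreover from D(1)[of m] have "(sub n has_real_derivative coeff D m) (at s)"
      by (rule has_field_derivative_transform_within_open[of _ _ _ "{0<..}"])
         (use s orthogonal_polys.subleading_Suc[OF fixed] Suc in auto)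
    ultimately show ?thesis by simp
  qed
qed

text \<open>By \<open>rec\<alpha>_eq\<close>, \<open>a n\<close> is a difference of subleading
  coefficients up to a constant; \<open>b_Suc_add\<close> removes \<open>b (Suc n)\<close> from its
  derivative.\<close>

lemma a_derivative:
  assumes s: "s > 0"
  shows "(a n has_real_derivative (2 * b n s - s + (2 * real n + 1 + \<alpha> + a n s) * a n s) / s) (at s)"
proof -
  interpret s: orthogonal_polys \<alpha> s "\<lambda>k. P k s" "\<lambda>k. h k s" by (rule fixed) (use s in simp)
  have "((\<lambda>t. sub n t - sub (Suc n) t - (2 * real n + 1 + \<alpha>)) has_real_derivative
      b n s / s - b (Suc n) s / s - 0) (at s)"
    by (intro DERIV_diff subleading_derivative s DERIV_const)
  then have "(a n has_real_derivative b n s / s - b (Suc n) s / s - 0) (at s)"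
  proof (rule has_field_derivative_transform_within_open[of _ _ _ "{0<..}"])
    show "sub n t - sub (Suc n) t - (2 * real n + 1 + \<alpha>) = a n t" if "t \<in> {0<..}" for t
      using orthogonal_polys.rec\<alpha>_eq[OF fixed, of t n] orthogonal_polys.rec\<alpha>_def[OF fixed, of t n] that
      by simp
  qed (use s in auto)
  moreover have "b n s / s - b (Suc n) s / s - 0
      = (2 * b n s - s + (2 * real n + 1 + \<alpha> + a n s) * a n s) / s"
    using s.b_Suc_add[of n] s.rec\<alpha>_eq[of n] by (simp flip: diff_divide_distrib)
  ultimately show ?thesis by simp
qed

lemma b_derivative:
  assumes s: "s > 0"
  shows "(b n has_real_derivative
    (2 * (b n s ^ 2 - s * b n s) / a n s + (2 * real n + 1 + \<alpha>) * b n s - real n * s) / s) (at s)"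
proof -
  interpret s: orthogonal_polys \<alpha> s "\<lambda>k. P k s" "\<lambda>k. h k s" by (rule fixed) (use s in simp)
  have der: "(b n has_real_derivative (\<beta> n s * (a (n - 1) s - a n s) + b n s) / s) (at s)"
  proof -
    have "(\<beta> n has_real_derivative \<beta> n s * (a (n - 1) s - a n s) / s) (at s)"
    proof (cases n)
      case 0
      have "((\<lambda>_. 0) has_real_derivative 0) (at s)" by simp
      then have "(\<beta> 0 has_real_derivative 0) (at s)"
        by (rule has_field_derivative_transform_within_open[of _ _ _ "{0<..}"])
           (use s orthogonal_polys.rec\<beta>_def[OF fixed] in auto)
      then show ?thesis by (simp add: 0 s.rec\<beta>_def)
    next
      case (Suc m)
      let ?F = "lin (\<alpha> - 1) s"
      have "((\<lambda>t. h n t / h m t) has_real_derivative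
        (- ?F (P n s * P n s) * h m s - h n s * - ?F (P m s * P m s)) / (h m s * h m s)) (at s)"
        using s.h_pos[of m] by (intro DERIV_divide h_derivative s) simp
      then have "(\<beta> n has_real_derivative
        (- ?F (P n s * P n s) * h m s - h n s * - ?F (P m s * P m s)) / (h m s * h m s)) (at s)"
        by (rule has_field_derivative_transform_within_open[of _ _ _ "{0<..}"])
           (use s orthogonal_polys.rec\<beta>_def[OF fixed] Suc in auto)
      moreover have "(- ?F (P n s * P n s) * h m s - h n s * - ?F (P m s * P m s)) / (h m s * h m s)
        = \<beta> n s * (a (n - 1) s - a n s) / s"
        using s.h_pos[of m] s.h_pos[of n] s Suc by (simp add: s.a_def s.rec\<beta>_def field_simps)
      ultimately show ?thesis by simp
    qed
    then have "((\<lambda>t. \<beta> n t + sub n t) has_real_derivative \<beta> n s * (a (n - 1) s - a n s) / s + b n s / s) (at s)"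
      by (intro DERIV_add subleading_derivative s)
    then have "(b n has_real_derivative \<beta> n s * (a (n - 1) s - a n s) / s + b n s / s) (at s)"
      by (rule has_field_derivative_transform_within_open[of _ _ _ "{0<..}"])
         (use s orthogonal_polys.rec\<beta>_eq[OF fixed] in auto)
    then show ?thesis by (simp add: add_divide_distrib)
  qed
  \<comment> \<open>By \<open>b_relation\<close>, \<open>w\<close> is
    \<open>\<beta>\<^sub>n a\<^sub>n\<^sub>-\<^sub>1\<close>; the sum relation then yields
    \<open>\<beta>\<^sub>n a\<^sub>n\<close>, so the index \<open>n - 1\<close> disappears and the
    system closes.\<close>
  define w where "w = (b n s ^ 2 - s * b n s) / a n s"
  have "\<beta> n s * a (n - 1) s = w"
    unfolding w_def using s.b_relation[of n] s.a_pos[OF s, of n] by (simp add: field_simps)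
  moreover have "\<beta> n s * a n s = real n * s - (2 * real n + \<alpha>) * b n s - \<beta> n s * a (n - 1) s"
    using s.rec\<beta>_a_sum[of n] by (simp add: distrib_left)
  ultimately have "\<beta> n s * (a (n - 1) s - a n s) + b n s
    = 2 * w + (2 * real n + 1 + \<alpha>) * b n s - real n * s"
    by (simp add: algebra_simps)
  with der show ?thesis by (simp add: w_def)
qed

lemma a_solves:
  "solves_ode2_on_pos (\<lambda>s x x'. x'\<^sup>2 / x - x' / s + (2 * real n + 1 + \<alpha>) * x\<^sup>2 / s\<^sup>2
     + x ^ 3 / s\<^sup>2 + \<alpha> / s - 1 / x) (a n)"
  unfolding solves_ode2_on_pos_def
proof (intro allI impI conjI)
  fix s :: real assume s: "s > 0"
  interpret s: orthogonal_polys \<alpha> s "\<lambda>k. P k s" "\<lambda>k. h k s" by (rule fixed) (use s in simp)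
  define L where "L = 2 * real n + 1 + \<alpha>"
  define G where "G = (\<lambda>s. (2 * b n s - s + (L + a n s) * a n s) / s)"
  \<comment> \<open>Required for all \<open>t > 0\<close> and not just at \<open>s\<close>, because
    \<open>deriv (a n)\<close> is itself differentiated.\<close>
  have dG: "deriv (a n) t = G t" if "t > 0" for t
    using DERIV_imp_deriv[OF a_derivative[OF that, of n]] by (simp add: G_def L_def)
  have da: "(a n has_real_derivative G s) (at s)"
    using a_derivative[OF s, of n] by (simp add: G_def L_def)
  define b' where "b' = (2 * (b n s ^ 2 - s * b n s) / a n s + L * b n s - real n * s) / s"
  have db: "(b n has_real_derivative b') (at s)"
    using b_derivative[OF s, of n] by (simp add: b'_def L_def)
  have "(G has_real_derivative ((2 * b' - 1 + ((L + a n s) * G s + G s * a n s)) * s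
     - (2 * b n s - s + (L + a n s) * a n s) * 1) / (s * s)) (at s)"
    unfolding G_def by (rule derivative_eq_intros da[unfolded G_def] db refl | use s in simp)+
  then have ddG: "(deriv (a n) has_real_derivative ((2 * b' - 1 + ((L + a n s) * G s + G s * a n s)) * s
     - (2 * b n s - s + (L + a n s) * a n s) * 1) / (s * s)) (at s)"
    by (rule has_field_derivative_transform_within_open[of _ _ _ "{0<..}"]) (use s dG in auto)
  show "a n s \<noteq> 0" using s.a_pos[OF s, of n] by simp
  show "a n differentiable at s" using da by (auto simp: real_differentiable_def)
  show "deriv (a n) differentiable at s" using ddG by (auto simp: real_differentiable_def)
  show "deriv (deriv (a n)) s = (deriv (a n) s)\<^sup>2 / a n s - deriv (a n) s / s
      + (2 * real n + 1 + \<alpha>) * (a n s)\<^sup>2 / s\<^sup>2 + (a n s) ^ 3 / s\<^sup>2 + \<alpha> / s - 1 / a n s"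
    unfolding DERIV_imp_deriv[OF ddG] dG[OF s] L_def[symmetric]
    by (rule painleve_identity[OF s s.a_pos[OF s] _ b'_def L_def]) (simp add: G_def)
qed

lemma a_derivative_zero: "(a n has_real_derivative 1 / \<alpha>) (at 0 within {0..})"
proof -
  interpret z: orthogonal_polys \<alpha> 0 "\<lambda>k. P k 0" "\<lambda>k. h k 0" by (rule fixed) simp
  interpret function_class "\<lambda>f. continuous (at 0 within {0..}) f" by (rule function_class_continuous)
  have m: "continuous (at 0 within {0..}) (mom (\<alpha> + real i))" for i
    using alpha by (intro mom_continuous_zero) auto
  \<comment> \<open>The exponent \<open>\<alpha> - 1\<close> may be negative; here continuity of the
    moments for all \<open>c > -1\<close> enters.\<close>
  have m': "continuous (at 0 within {0..}) (mom (\<alpha> - 1 + real i))" for i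
    using alpha by (intro mom_continuous_zero) auto
  note PR = coefficients_closed[OF function_class_continuous m]
  have "continuous (at 0 within {0..}) (\<lambda>s. lin (\<alpha> - 1) s (P n s * P n s) * inverse (h n s))"
  proof (intro mult inverse PR)
    show "continuous (at 0 within {0..}) (\<lambda>s. lin (\<alpha> - 1) s (P n s * P n s))"
      using alpha by (intro lin_closed[where N = "n + n"] coeff_mult_closed m' PR
        order_trans[OF degree_mult_le]) (auto simp: degree_P)
  qed (rule h_pos)
  then have lim: "((\<lambda>s. lin (\<alpha> - 1) s (P n s * P n s) * inverse (h n s)) \<longlongrightarrow>
      lin (\<alpha> - 1) 0 (P n 0 * P n 0) * inverse (h n 0)) (at 0 within {0..})"
    by (simp add: continuous_within)
  \<comment> \<open>As \<open>P\<^sub>n'\<close> is zero or of degree below \<open>n\<close>, the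
    derivative term drops out and \<open>\<alpha> F (P\<^sub>n P\<^sub>n) = h\<^sub>n\<close>
    remains.\<close>
  have "lin \<alpha> 0 (P n 0 * pderiv (P n 0)) = 0"
  proof (cases n)
    case 0
    then show ?thesis by (simp add: z.P_0)
  next
    case (Suc m)
    then show ?thesis by (intro z.E_P_lower) (simp add: degree_pderiv)
  qed
  then have "\<alpha> * lin (\<alpha> - 1) 0 (P n 0 * P n 0) = h n 0"
    using lin_integration_by_parts_zero[OF alpha, of "P n 0 * P n 0"] z.E_P_P[of n n]
    unfolding pderiv_mult z.E_add by simp
  then have val: "lin (\<alpha> - 1) 0 (P n 0 * P n 0) * inverse (h n 0) = 1 / \<alpha>"
    using z.h_pos[of n] alpha by (simp add: field_simps)
  have "((\<lambda>s. (a n s - a n 0) / (s - 0)) \<longlongrightarrow> 1 / \<alpha>) (at 0 within {0..})"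
  proof (rule Lim_transform_eventually[OF lim[unfolded val]])
    show "\<forall>\<^sub>F s in at 0 within {0..}. lin (\<alpha> - 1) s (P n s * P n s) * inverse (h n s) = (a n s - a n 0) / (s - 0)"
      unfolding eventually_at_filter
      by (intro always_eventually)
         (simp add: orthogonal_polys.a_def[OF fixed] divide_inverse)
  qed
  then show ?thesis by (simp add: has_field_derivative_iff)
qed

lemma aux_a_eq: "s \<ge> 0 \<Longrightarrow> aux_a \<alpha> P h n s = a n s"
  using orthogonal_polys.a_eq_aux_a[OF fixed] by (simp add: aux_a_def)

end

text \<open>Serves twice: \<open>c = 1\<close> carries the equation over to \<open>aux_a\<close>,
  and \<open>c = -1\<close> to \<open>q\<close>. Agreement on \<open>s > 0\<close> is enough because
  that set is open.\<close>

lemma solves_ode2_on_pos_transfer: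
  assumes F: "solves_ode2_on_pos F y" and z: "\<And>s. s > 0 \<Longrightarrow> z s = c * y s" and "c \<noteq> 0"
    and G: "\<And>s u v. s > 0 \<Longrightarrow> u \<noteq> 0 \<Longrightarrow> G s (c * u) (c * v) = c * F s u v"
  shows "solves_ode2_on_pos G z"
  unfolding solves_ode2_on_pos_def
proof (intro allI impI)
  fix s :: real assume s: "s > 0"
  have tr: "(g has_real_derivative c * d) (at t)"
    if "(f has_real_derivative d) (at t)" "\<And>s. s > 0 \<Longrightarrow> g s = c * f s" "t > 0" for f g :: "real \<Rightarrow> real" and d t
    by (rule has_field_derivative_transform_within_open[OF DERIV_cmult[OF that(1)], of "{0<..}"])
       (use that in auto)
  have F': "y t \<noteq> 0" "y differentiable (at t)" "deriv y differentiable (at t)"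
      "deriv (deriv y) t = F t (y t) (deriv y t)" if "t > 0" for t
    using F that unfolding solves_ode2_on_pos_def by blast+
  have 1: "(z has_real_derivative c * deriv y t) (at t)" if "t > 0" for t
    using F'(2)[OF that] z that by (intro tr[of y]) (auto simp: DERIV_deriv_iff_real_differentiable)
  then have e: "deriv z t = c * deriv y t" if "t > 0" for t
    using that by (intro DERIV_imp_deriv)
  have 2: "(deriv z has_real_derivative c * deriv (deriv y) s) (at s)"
    using F'(3)[OF s] e s by (intro tr[of "deriv y"]) (auto simp: DERIV_deriv_iff_real_differentiable)
  show "z s \<noteq> 0 \<and> z differentiable at s \<and> deriv z differentiable at s
      \<and> deriv (deriv z) s = G s (z s) (deriv z s)"
    using 1[OF s] 2 DERIV_imp_deriv[OF 2] F'[OF s] e[OF s] z[OF s] G[OF s] \<open>c \<noteq> 0\<close>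
    by (auto simp: real_differentiable_def)
qed

theorem theorem1:
  fixes \<alpha> :: real and n :: nat
    and P :: "nat \<Rightarrow> real \<Rightarrow> real poly" and h :: "nat \<Rightarrow> real \<Rightarrow> real"
  assumes "\<alpha> > 0"
    and "\<And>s. s \<ge> 0 \<Longrightarrow> monic_orthogonal \<alpha> s (\<lambda>k. P k s) (\<lambda>k. h k s)"
  defines "a \<equiv> aux_a \<alpha> P h n"
  shows "solves_ode2_on_pos
           (\<lambda>s a a'. a'\<^sup>2 / a - a' / s + (2 * real n + 1 + \<alpha>) * a\<^sup>2 / s\<^sup>2
                      + a ^ 3 / s\<^sup>2 + \<alpha> / s - 1 / a) a
       \<and> a 0 = 0
       \<and> (a has_real_derivative 1 / \<alpha>) (at 0 within {0..})
       \<and> (\<forall>q. (\<forall>s>0. a s = - q s) \<longrightarrow>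
              PIII' (- 4 * (2 * real n + 1 + \<alpha>)) (- 4 * \<alpha>) 4 (- 4) q)"
proof -
  interpret orthogonal_family \<alpha> P h by unfold_locales (use assms in auto)
  have ode: "solves_ode2_on_pos
           (\<lambda>s a a'. a'\<^sup>2 / a - a' / s + (2 * real n + 1 + \<alpha>) * a\<^sup>2 / s\<^sup>2
                      + a ^ 3 / s\<^sup>2 + \<alpha> / s - 1 / a) a"
    by (rule solves_ode2_on_pos_transfer[OF a_solves[of n], of _ 1]) (auto simp: a_def aux_a_eq)
  moreover have "a 0 = 0" by (simp add: a_def aux_a_def)
  moreover have "(a has_real_derivative 1 / \<alpha>) (at 0 within {0..})"
    using a_derivative_zero[of n]
    by (rule has_field_derivative_transform_within[of _ _ _ _ 1]) (auto simp: a_def aux_a_eq)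
  moreover have "PIII' (- 4 * (2 * real n + 1 + \<alpha>)) (- 4 * \<alpha>) 4 (- 4) q" if "\<forall>s>0. a s = - q s" for q
    unfolding PIII'_def
  \<comment> \<open>Under \<open>q = - a\<close> the terms even in \<open>a\<close> change sign,
    whence \<open>- 4 * (2 * real n + 1 + \<alpha>)\<close> and \<open>- 4 * \<alpha>\<close>; the
    odd ones keep theirs, whence \<open>4\<close> and \<open>- 4\<close>. The factor 4 offsets the
    denominators.\<close>
  proof (rule solves_ode2_on_pos_transfer[OF ode, of _ "-1"])
    show "q s = -1 * a s" if "s > 0" for s using that \<open>\<forall>s>0. a s = - q s\<close> by simp
  qed (simp_all add: field_simps power2_eq_square power3_eq_cube)
  ultimately show ?thesis by blast
qed

end
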